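(* Let $(X,\leq)$ be a partially ordered set endowed with a metric $d$ such that $(X,d)$ is complete, let $\varepsilon>0$ and $\lambda\in(0,1)$, and let $F:X\times X\to X$ be a mapping. Assume that: 1. $X$ is $\varepsilon$-chainable with respect to the partial order $\leq$; 2. at least one of the following holds: (i) $F$ is continuous; or (ii) whenever $\{u_m\}$ is a nondecreasing sequence in $X$ converging to $u$ in $(X,d)$ one has $u_m\leq u$ for all $m$, and whenever $\{v_m\}$ is a nonincreasing sequence in $X$ converging to $v$ in $(X,d)$ one has $v_m\geq v$ for all $m$; 3. $F$ has the mixed monotone property; 4. $F$ is $(\varepsilon,\lambda)$ uniformly locally contractive; 5. $x_0,y_0\in X$ satisfy $x_0\leq F(x_0,y_0)$ and $y_0\geq F(y_0,x_0)$; 6. $x_0$ and $y_0$ are comparable (i.e. $x_0\leq y_0$ or $y_0\leq x_0$). Let $(x,y)\in X\times X$ be the coupled fixed point of $F$ (i.e. $F(x,y)=x$ and $F(y,x)=y$) given by $x=\lim_{m\to+\infty}F^m(x_0,y_0)$ and $y=\lim_{m\to+\infty}F^m(y_0,x_0)$. Then $x=y$.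
   Context: Let $(X,\leq)$ be a partially ordered set endowed with a metric $d$ and let $F:X\times X\to X$. The iterates of $F$ are $F^0(x,y)=x$, $F^1(x,y)=F(x,y)$, and $F^{m+1}(x,y)=F(F^m(x,y),F^m(y,x))$. $X\times X$ carries the metric $\eta((x,y),(u,v))=d(x,u)+d(y,v)$; continuity of $F$ is with respect to $\eta$ and $d$. $X$ is $\varepsilon$-chainable with respect to $\leq$ ($\varepsilon>0$) if for any $a,b\in X$ with $a\leq b$ there exist an integer $n\geq 1$ and points $a=\alpha_0\leq\alpha_1\leq\cdots\leq\alpha_{n-1}\leq\alpha_n=b$ of $X$ such that $d(\alpha_{i-1},\alpha_i)<\varepsilon$ for all $i=1,\dots,n$. $F$ has the mixed monotone property if for all $x,y\in X$: $x_1\leq x_2$ in $X$ implies $F(x_1,y)\leq F(x_2,y)$, and $y_1\leq y_2$ in $X$ implies $F(x,y_1)\geq F(x,y_2)$. $F$ is $(\varepsilon,\lambda)$ uniformly locally contractive ($\varepsilon>0$, $\lambda\in(0,1)$) if for all $x,y,u,v\in X$ with $x\geq u$, $y\leq v$ and $(x,y)\neq(u,v)$: $\frac{d(x,u)+d(y,v)}{2}<\varepsilon$ implies $d(F(x,y),F(u,v))<\frac{\lambda}{2}[d(x,u)+d(y,v)]$. *)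

theory Defs
  imports "HOL-Analysis.Analysis"
begin

text \<open>
  The partially ordered complete metric space \<open>X\<close> is a type of sort
  \<open>{order, complete_space}\<close>; these classes impose no compatibility between
  the order and the metric.
\<close>

primrec coupled_iterate :: "('a \<times> 'a \<Rightarrow> 'a) \<Rightarrow> nat \<Rightarrow> 'a \<Rightarrow> 'a \<Rightarrow> 'a" where
  "coupled_iterate F 0 = (\<lambda>x y. x)"
| "coupled_iterate F (Suc m) =
     (\<lambda>x y. F (coupled_iterate F m x y, coupled_iterate F m y x))"

definition coupled_fixed_point :: "('a \<times> 'a \<Rightarrow> 'a) \<Rightarrow> 'a \<Rightarrow> 'a \<Rightarrow> bool" where
  "coupled_fixed_point F x y \<longleftrightarrow> F (x, y) = x \<and> F (y, x) = y"

text \<open>The sum metric; the library's \<open>dist\<close> on pairs is the Euclidean combination instead.\<close>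

definition eta :: "'a::metric_space \<times> 'a \<Rightarrow> 'a \<times> 'a \<Rightarrow> real" where
  "eta p q = dist (fst p) (fst q) + dist (snd p) (snd q)"

lemma Metric_space_eta: "Metric_space UNIV eta"
proof
  fix p q r :: "'a::metric_space \<times> 'a"
  show "0 \<le> eta p q" by (simp add: eta_def)
  show "eta p q = eta q p" by (simp add: eta_def dist_commute)
  show "eta p q = 0 \<longleftrightarrow> p = q"
    by (simp add: eta_def add_nonneg_eq_0_iff prod_eq_iff)
  show "eta p r \<le> eta p q + eta q r"
    using dist_triangle[of "fst p" "fst r" "fst q"] dist_triangle[of "snd p" "snd r" "snd q"]
    by (simp add: eta_def)
qed

definition eta_continuous :: "('a::metric_space \<times> 'a \<Rightarrow> 'a) \<Rightarrow> bool" where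
  "eta_continuous F \<longleftrightarrow> continuous_map (Metric_space.mtopology UNIV eta) euclidean F"

definition order_chainable :: "real \<Rightarrow> 'a::{order, metric_space} itself \<Rightarrow> bool" where
  "order_chainable \<epsilon> _ \<longleftrightarrow>
     (\<forall>a b :: 'a. a \<le> b \<longrightarrow>
        (\<exists>(n::nat) (\<alpha> :: nat \<Rightarrow> 'a). n \<ge> 1 \<and> \<alpha> 0 = a \<and> \<alpha> n = b \<and>
           (\<forall>i\<in>{1..n}. \<alpha> (i - 1) \<le> \<alpha> i \<and> dist (\<alpha> (i - 1)) (\<alpha> i) < \<epsilon>)))"

definition mixed_monotone :: "('a::order \<times> 'a \<Rightarrow> 'a) \<Rightarrow> bool" where
  "mixed_monotone F \<longleftrightarrow>
     (\<forall>x y. (\<forall>x1 x2. x1 \<le> x2 \<longrightarrow> F (x1, y) \<le> F (x2, y)) \<and>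
            (\<forall>y1 y2. y1 \<le> y2 \<longrightarrow> F (x, y1) \<ge> F (x, y2)))"

definition unif_locally_contractive ::
    "real \<Rightarrow> real \<Rightarrow> ('a::{order, metric_space} \<times> 'a \<Rightarrow> 'a) \<Rightarrow> bool" where
  "unif_locally_contractive \<epsilon> l F \<longleftrightarrow>
     (\<forall>x y u v. x \<ge> u \<and> y \<le> v \<and> (x, y) \<noteq> (u, v) \<longrightarrow>
        (dist x u + dist y v) / 2 < \<epsilon> \<longrightarrow>
        dist (F (x, y)) (F (u, v)) < l / 2 * (dist x u + dist y v))"

definition monotone_limits_bound :: "'a::{order, metric_space} itself \<Rightarrow> bool" where
  "monotone_limits_bound _ \<longleftrightarrow>
     (\<forall>(s :: nat \<Rightarrow> 'a) u. incseq s \<longrightarrow> s \<longlonglongrightarrow> u \<longrightarrow> (\<forall>m. s m \<le> u)) \<and>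
     (\<forall>(s :: nat \<Rightarrow> 'a) v. decseq s \<longrightarrow> s \<longlonglongrightarrow> v \<longrightarrow> (\<forall>m. s m \<ge> v))"

text \<open>The coupled fixed point obtained as the limit of the iterates started at \<open>(x0, y0)\<close>.\<close>

definition limit_coupled_fixed_point ::
    "('a::metric_space \<times> 'a \<Rightarrow> 'a) \<Rightarrow> 'a \<Rightarrow> 'a \<Rightarrow> 'a \<Rightarrow> 'a \<Rightarrow> bool" where
  "limit_coupled_fixed_point F x0 y0 x y \<longleftrightarrow>
     coupled_fixed_point F x y \<and>
     (\<lambda>m. coupled_iterate F m x0 y0) \<longlonglongrightarrow> x \<and>
     (\<lambda>m. coupled_iterate F m y0 x0) \<longlonglongrightarrow> y"

end

theory Submission
  imports Defs
begin

text \<open>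
  Put \<open>T (x, y) = (F (x, y), F (y, x))\<close> on \<open>X \<times> X\<close> and order pairs by
  \<open>(u, v) \<sqsubseteq> (x, y)\<close> iff \<open>u \<le> x\<close> and \<open>y \<le> v\<close>.  Coupled fixed points of \<open>F\<close> are fixed points
  of \<open>T\<close>, the coupled iterates are the components of the powers of \<open>T\<close>, and the mixed monotone
  property says that \<open>T\<close> is monotone for \<open>\<sqsubseteq>\<close>.  Adding the two instances of the local
  contraction for the two components of \<open>T\<close>, one finds that \<open>T\<close> shrinks \<open>eta\<close> by the factor
  \<open>l\<close> on \<open>\<sqsubseteq>\<close>-related pairs at distance less than \<open>2\<epsilon>\<close>.

  Consequently the \<open>T\<close>-orbits of two such pairs approach each other at the rate \<open>l ^ m\<close>.
  Having orbits that approach each other at this rate is a transitive relation, so chainability,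
  applied to one component after the other, extends it to all \<open>\<sqsubseteq>\<close>-related pairs
  (\<open>mixed_le_imp_geometrically_asymptotic\<close>).

  This fact is used twice.  Since \<open>P = (x0, y0) \<sqsubseteq> T P\<close>, the distances between
  consecutive points of the orbit of \<open>P\<close> are summable; the orbit converges, and
  its limit is a fixed point either by continuity or because the limit is a \<open>\<sqsubseteq>\<close>-upper
  bound of the orbit, so that the contraction applies near it.  Since \<open>x0\<close> and \<open>y0\<close> are
  comparable, \<open>(x0, y0)\<close> and \<open>(y0, x0)\<close> are \<open>\<sqsubseteq>\<close>-related in one direction
  or the other; their orbits are mirror images of each other and yet approach each other, which forces \<open>x = y\<close>.
\<close>

section \<open>The sum metric and its sequences\<close>

lemmas eta_triangle = Metric_space.triangle[OF Metric_space_eta, OF UNIV_I UNIV_I UNIV_I]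

lemma eta_nonneg [simp]: "0 \<le> eta p q"
  by (simp add: eta_def)

lemma eta_commute: "eta p q = eta q p"
  by (simp add: eta_def dist_commute)

lemma dist_le_eta: "dist p q \<le> eta p q"
  unfolding dist_prod_def eta_def by (rule sqrt_sum_squares_le_sum) auto

lemma tendsto_iff_eta_tendsto_0: "(f \<longlongrightarrow> p) A \<longleftrightarrow> ((\<lambda>i. eta (f i) p) \<longlongrightarrow> 0) A"
proof
  assume f: "(f \<longlongrightarrow> p) A"
  show "((\<lambda>i. eta (f i) p) \<longlongrightarrow> 0) A"
    unfolding eta_def
    using tendsto_add[OF tendsto_dist[OF tendsto_fst[OF f] tendsto_const[of "fst p"]]
        tendsto_dist[OF tendsto_snd[OF f] tendsto_const[of "snd p"]]]
    by simp
next
  assume "((\<lambda>i. eta (f i) p) \<longlongrightarrow> 0) A"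
  then have "((\<lambda>i. dist (f i) p) \<longlongrightarrow> 0) A"
    by (rule Lim_null_comparison[rotated]) (simp add: dist_le_eta)
  then show "(f \<longlongrightarrow> p) A"
    by (rule tendsto_dist_iff[THEN iffD2])
qed

lemma eta_continuous_tendsto:
  assumes "eta_continuous F" and "(f \<longlongrightarrow> p) A"
  shows "((\<lambda>i. F (f i)) \<longlongrightarrow> F p) A"
proof -
  have "limitin (Metric_space.mtopology UNIV eta) f p A"
    using assms(2)
    by (simp add: Metric_space.limitin_metric_dist_null[OF Metric_space_eta]
        tendsto_iff_eta_tendsto_0)
  from continuous_map_limit[OF assms(1)[unfolded eta_continuous_def] this] show ?thesis
    by (simp add: o_def)
qed

lemma Cauchy_if_dist_Suc_summable:
  fixes s :: "nat \<Rightarrow> 'a::metric_space"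
  assumes "summable f" and step: "\<And>n. dist (s n) (s (Suc n)) \<le> f n"
  shows "Cauchy s"
proof -
  have *: "dist (s m) (s n) \<le> sum f {m..<n}" if "m \<le> n" for m n
    using that
  proof (induction n rule: dec_induct)
    case (step n)
    have "dist (s m) (s (Suc n)) \<le> dist (s m) (s n) + dist (s n) (s (Suc n))"
      by (rule dist_triangle)
    also have "\<dots> \<le> sum f {m..<n} + f n"
      by (intro add_mono step.IH assms(2))
    finally show ?case
      using step.hyps by simp
  qed simp
  show ?thesis
    unfolding Cauchy_altdef
  proof (intro allI impI)
    fix e :: real
    assume "e > 0"
    with assms(1) obtain N where N: "\<And>m n. m \<ge> N \<Longrightarrow> norm (sum f {m..<n}) < e"
      unfolding summable_Cauchy by blast
    show "\<exists>M. \<forall>m\<ge>M. \<forall>n>m. dist (s m) (s n) < e"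
    proof (intro exI[of _ N] allI impI)
      fix m n
      assume "m \<ge> N" "n > m"
      then have "dist (s m) (s n) \<le> sum f {m..<n}" "norm (sum f {m..<n}) < e"
        by (simp_all add: * N del: real_norm_def)
      then show "dist (s m) (s n) < e"
        by simp
    qed
  qed
qed

section \<open>The self-map of pairs induced by a coupled map\<close>

definition coupled_map :: "('a \<times> 'a \<Rightarrow> 'a) \<Rightarrow> 'a \<times> 'a \<Rightarrow> 'a \<times> 'a" where
  "coupled_map F p = (F p, F (prod.swap p))"

lemma funpow_coupled_map:
  "(coupled_map F ^^ m) (x, y) = (coupled_iterate F m x y, coupled_iterate F m y x)"
  by (induction m) (simp_all add: coupled_map_def)

lemma coupled_fixed_point_iff: "coupled_fixed_point F x y \<longleftrightarrow> coupled_map F (x, y) = (x, y)"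
  by (simp add: coupled_fixed_point_def coupled_map_def)

lemma limit_coupled_fixed_point_iff:
  "limit_coupled_fixed_point F x0 y0 x y \<longleftrightarrow>
     coupled_map F (x, y) = (x, y) \<and> (\<lambda>m. (coupled_map F ^^ m) (x0, y0)) \<longlonglongrightarrow> (x, y)"
  unfolding limit_coupled_fixed_point_def coupled_fixed_point_iff funpow_coupled_map
  by (auto intro: tendsto_Pair dest: tendsto_fst tendsto_snd)

definition mixed_le :: "'a::order \<times> 'a \<Rightarrow> 'a \<times> 'a \<Rightarrow> bool" where
  "mixed_le p q \<longleftrightarrow> fst p \<le> fst q \<and> snd q \<le> snd p"

lemma coupled_map_mono:
  assumes "mixed_monotone F" and "mixed_le p q"
  shows "mixed_le (coupled_map F p) (coupled_map F q)"
proof -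
  have F: "F (u, v) \<le> F (x, y)" if "u \<le> x" "y \<le> v" for u v x y
    using assms(1) that unfolding mixed_monotone_def by (meson order_trans)
  show ?thesis
    using assms(2) by (cases p; cases q) (auto simp: mixed_le_def coupled_map_def intro: F)
qed

lemma funpow_coupled_map_mono:
  assumes "mixed_monotone F" and "mixed_le p q"
  shows "mixed_le ((coupled_map F ^^ m) p) ((coupled_map F ^^ m) q)"
  by (induction m) (simp_all add: assms coupled_map_mono)

text \<open>
  The contraction hypothesis bounds each component of the image by half of \<open>l * eta p q\<close>; for the
  second component it is applied to the swapped pairs, whose order is reversed.
\<close>

lemma coupled_map_contractive:
  assumes "unif_locally_contractive \<epsilon> l F" and "mixed_le p q" and "eta p q < 2 * \<epsilon>"
  shows "eta (coupled_map F p) (coupled_map F q) \<le> l * eta p q"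
proof (cases "p = q")
  case False
  obtain u v x y where pq: "p = (u, v)" "q = (x, y)"
    by (cases p; cases q)
  have F: "dist (F (x, y)) (F (u, v)) < l / 2 * (dist x u + dist y v)"
    if "u \<le> x" "y \<le> v" "(x, y) \<noteq> (u, v)" "(dist x u + dist y v) / 2 < \<epsilon>" for x y u v
    using assms(1) that unfolding unif_locally_contractive_def by blast
  have le: "u \<le> x" "y \<le> v" and near: "(dist x u + dist y v) / 2 < \<epsilon>"
    using assms(2,3) by (auto simp: pq mixed_le_def eta_def dist_commute)
  have "dist (F (x, y)) (F (u, v)) < l / 2 * (dist x u + dist y v)"
    using F[OF le] False near by (auto simp: pq)
  moreover have "dist (F (v, u)) (F (y, x)) < l / 2 * (dist v y + dist u x)"
    using F[OF le(2,1)] False near by (auto simp: pq dist_commute add.commute)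
  ultimately show ?thesis
    by (simp add: pq eta_def coupled_map_def dist_commute field_simps)
qed (simp add: eta_def)

section \<open>Orbits approaching each other geometrically\<close>

definition geometrically_asymptotic ::
    "('a::metric_space \<times> 'a \<Rightarrow> 'a \<times> 'a) \<Rightarrow> real \<Rightarrow> 'a \<times> 'a \<Rightarrow> 'a \<times> 'a \<Rightarrow> bool" where
  "geometrically_asymptotic T l p q \<longleftrightarrow> (\<exists>C. \<forall>m. eta ((T ^^ m) p) ((T ^^ m) q) \<le> C * l ^ m)"

lemma geometrically_asymptotic_refl: "geometrically_asymptotic T l p p"
  unfolding geometrically_asymptotic_def by (rule exI[of _ 0]) (simp add: eta_def)

lemma geometrically_asymptotic_sym:
  "geometrically_asymptotic T l p q \<Longrightarrow> geometrically_asymptotic T l q p"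
  unfolding geometrically_asymptotic_def by (simp add: eta_commute)

lemma geometrically_asymptotic_trans:
  assumes "geometrically_asymptotic T l p q" and "geometrically_asymptotic T l q r"
  shows "geometrically_asymptotic T l p r"
proof -
  obtain C D where C: "\<And>m. eta ((T ^^ m) p) ((T ^^ m) q) \<le> C * l ^ m"
    and D: "\<And>m. eta ((T ^^ m) q) ((T ^^ m) r) \<le> D * l ^ m"
    using assms unfolding geometrically_asymptotic_def by blast
  have "eta ((T ^^ m) p) ((T ^^ m) r) \<le> (C + D) * l ^ m" for m
    using eta_triangle[of "(T ^^ m) p" "(T ^^ m) r" "(T ^^ m) q"] C[of m] D[of m]
    by (simp add: distrib_right)
  then show ?thesis
    unfolding geometrically_asymptotic_def by blast
qed

lemma geometrically_asymptotic_tendsto_0: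
  assumes "geometrically_asymptotic T l p q" and "0 < l" and "l < 1"
  shows "(\<lambda>m. eta ((T ^^ m) p) ((T ^^ m) q)) \<longlonglongrightarrow> 0"
proof -
  obtain C where C: "\<And>m. eta ((T ^^ m) p) ((T ^^ m) q) \<le> C * l ^ m"
    using assms(1) unfolding geometrically_asymptotic_def by blast
  have "(\<lambda>m. C * l ^ m) \<longlonglongrightarrow> C * 0"
    using assms(2,3) by (intro tendsto_mult tendsto_const LIMSEQ_power_zero) simp
  then show ?thesis
    using Lim_null_comparison[of "\<lambda>m. eta ((T ^^ m) p) ((T ^^ m) q)" "\<lambda>m. C * l ^ m"]
    by (simp add: C)
qed

lemma geometrically_asymptotic_if_near:
  assumes "0 < l" and "l < 1"
    and mono: "mixed_monotone F" and contr: "unif_locally_contractive \<epsilon> l F"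
    and le: "mixed_le p q" and near: "eta p q < 2 * \<epsilon>"
  shows "geometrically_asymptotic (coupled_map F) l p q"
proof -
  let ?T = "coupled_map F"
  have "eta ((?T ^^ m) p) ((?T ^^ m) q) \<le> eta p q * l ^ m" for m
  proof (induction m)
    case (Suc m)
    have "eta p q * l ^ m \<le> eta p q"
      using assms(1,2) by (simp add: mult_left_le power_le_one)
    \<comment> \<open>The distance never grows, so the contraction stays applicable along both orbits.\<close>
    with Suc.IH near have "eta ((?T ^^ m) p) ((?T ^^ m) q) < 2 * \<epsilon>"
      by linarith
    then have "eta ((?T ^^ Suc m) p) ((?T ^^ Suc m) q) \<le> l * eta ((?T ^^ m) p) ((?T ^^ m) q)"
      using coupled_map_contractive[OF contr funpow_coupled_map_mono[OF mono le]] by simp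
    also have "\<dots> \<le> l * (eta p q * l ^ m)"
      using Suc.IH assms(1) by (intro mult_left_mono) auto
    finally show ?case
      by (simp add: mult_ac)
  qed simp
  then show ?thesis
    unfolding geometrically_asymptotic_def by blast
qed

lemma order_chainable_induct:
  fixes a b :: "'a::{order, metric_space}"
  assumes "order_chainable \<epsilon> TYPE('a)" and "a \<le> b"
    and refl: "\<And>c. R c c"
    and trans: "\<And>c d e. R c d \<Longrightarrow> R d e \<Longrightarrow> R c e"
    and step: "\<And>c d. c \<le> d \<Longrightarrow> dist c d < \<epsilon> \<Longrightarrow> R c d"
  shows "R a b"
proof -
  obtain n :: nat and \<alpha> :: "nat \<Rightarrow> 'a" where ends: "\<alpha> 0 = a" "\<alpha> n = b"
    and chain: "\<And>i. i \<in> {1..n} \<Longrightarrow> \<alpha> (i - 1) \<le> \<alpha> i \<and> dist (\<alpha> (i - 1)) (\<alpha> i) < \<epsilon>"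
    using assms(1,2) unfolding order_chainable_def by blast
  have "R (\<alpha> 0) (\<alpha> i)" if "i \<le> n" for i
    using that
  proof (induction i)
    case (Suc i)
    then have "R (\<alpha> 0) (\<alpha> i)"
      by simp
    moreover have "R (\<alpha> i) (\<alpha> (Suc i))"
      using chain[of "Suc i"] Suc.prems by (intro step) simp_all
    ultimately show ?case
      by (rule trans)
  qed (rule refl)
  then show ?thesis
    using ends by blast
qed

text \<open>
  From \<open>(u, v)\<close> one moves to \<open>(x, v)\<close> along a chain in the first component, and then to
  \<open>(x, y)\<close> along a chain from \<open>y\<close> up to \<open>v\<close>, traversed backwards.
\<close>

lemma mixed_le_imp_geometrically_asymptotic:
  fixes F :: "'a::{order, metric_space} \<times> 'a \<Rightarrow> 'a"
  assumes "0 < l" and "l < 1" and "order_chainable \<epsilon> TYPE('a)"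
    and "mixed_monotone F" and "unif_locally_contractive \<epsilon> l F" and "mixed_le p q"
  shows "geometrically_asymptotic (coupled_map F) l p q"
proof -
  let ?A = "geometrically_asymptotic (coupled_map F) l"
  obtain u v x y where pq: "p = (u, v)" "q = (x, y)"
    by (cases p; cases q)
  have near: "?A (c, e) (d, f)" if "c \<le> d" "f \<le> e" "dist c d + dist e f < \<epsilon>" for c d e f
  proof -
    have "0 \<le> dist c d + dist e f"
      by simp
    then have "eta (c, e) (d, f) < 2 * \<epsilon>"
      using that(3) unfolding eta_def fst_conv snd_conv by linarith
    then show ?thesis
      using that
      by (intro geometrically_asymptotic_if_near[OF assms(1,2,4,5)]) (simp_all add: mixed_le_def)
  qed
  have "u \<le> x" "y \<le> v"
    using assms(6) by (simp_all add: pq mixed_le_def)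
  have "?A (u, v) (x, v)"
  proof (rule order_chainable_induct[OF assms(3) \<open>u \<le> x\<close>, where R = "\<lambda>c d. ?A (c, v) (d, v)"])
    show "?A (c, v) (d, v)" if "c \<le> d" "dist c d < \<epsilon>" for c d
      using that by (intro near) simp_all
  qed (fact geometrically_asymptotic_refl, fact geometrically_asymptotic_trans)
  moreover have "?A (x, y) (x, v)"
  proof (rule order_chainable_induct[OF assms(3) \<open>y \<le> v\<close>, where R = "\<lambda>c d. ?A (x, c) (x, d)"])
    show "?A (x, c) (x, d)" if "c \<le> d" "dist c d < \<epsilon>" for c d
      using that by (intro geometrically_asymptotic_sym[OF near]) (simp_all add: dist_commute)
  qed (fact geometrically_asymptotic_refl, fact geometrically_asymptotic_trans)
  ultimately show ?thesis
    unfolding pq by (meson geometrically_asymptotic_sym geometrically_asymptotic_trans)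
qed

section \<open>Convergence of the iterates to a coupled fixed point\<close>

lemma coupled_iterates_convergent:
  fixes F :: "'a::{order, complete_space} \<times> 'a \<Rightarrow> 'a"
  assumes "0 < l" and "l < 1" and "order_chainable \<epsilon> TYPE('a)"
    and "mixed_monotone F" and "unif_locally_contractive \<epsilon> l F"
    and "mixed_le p (coupled_map F p)"
  shows "convergent (\<lambda>m. (coupled_map F ^^ m) p)"
proof -
  let ?T = "coupled_map F"
  obtain C where C: "\<And>m. eta ((?T ^^ m) p) ((?T ^^ m) (?T p)) \<le> C * l ^ m"
    using mixed_le_imp_geometrically_asymptotic[OF assms]
    unfolding geometrically_asymptotic_def by blast
  have "Cauchy (\<lambda>m. (?T ^^ m) p)"
  proof (rule Cauchy_if_dist_Suc_summable)
    show "summable (\<lambda>m. C * l ^ m)"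
      using assms(1,2) by (intro summable_mult summable_geometric) simp
    show "dist ((?T ^^ m) p) ((?T ^^ Suc m) p) \<le> C * l ^ m" for m
      using order_trans[OF dist_le_eta C[of m]] by (simp add: funpow_swap1)
  qed
  then show ?thesis
    by (simp add: Cauchy_convergent_iff)
qed

lemma mixed_le_limit:
  fixes s :: "nat \<Rightarrow> 'a::{order, metric_space} \<times> 'a"
  assumes "monotone_limits_bound TYPE('a)"
    and "\<And>m. mixed_le (s m) (s (Suc m))" and "s \<longlonglongrightarrow> z"
  shows "mixed_le (s m) z"
proof -
  have "incseq (\<lambda>m. fst (s m))" "decseq (\<lambda>m. snd (s m))"
    using assms(2) by (auto simp: mixed_le_def intro: incseq_SucI decseq_SucI)
  then show ?thesis
    using assms(1) tendsto_fst[OF assms(3)] tendsto_snd[OF assms(3)]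
    unfolding monotone_limits_bound_def mixed_le_def by blast
qed

text \<open>
  When the limit bounds the orbit, the orbit points are eventually within reach of the local
  contraction at the limit, which replaces continuity there.
\<close>

lemma coupled_iterates_limit_fixed:
  fixes F :: "'a::{order, metric_space} \<times> 'a \<Rightarrow> 'a"
  assumes "\<epsilon> > 0"
    and cases: "eta_continuous F \<or> monotone_limits_bound TYPE('a)"
    and mono: "mixed_monotone F" and contr: "unif_locally_contractive \<epsilon> l F"
    and start: "mixed_le p (coupled_map F p)"
    and lim: "(\<lambda>m. (coupled_map F ^^ m) p) \<longlonglongrightarrow> z"
  shows "coupled_map F z = z"
proof -
  let ?T = "coupled_map F"
  let ?s = "\<lambda>m. (?T ^^ m) p"
  have "(\<lambda>m. ?T (?s m)) \<longlonglongrightarrow> ?T z"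
    using cases
  proof
    assume cont: "eta_continuous F"
    have "(\<lambda>m. prod.swap (?s m)) \<longlonglongrightarrow> prod.swap z"
      using tendsto_Pair[OF tendsto_snd[OF lim] tendsto_fst[OF lim]]
      by (simp add: prod.swap_def)
    then show ?thesis
      unfolding coupled_map_def
      by (intro tendsto_Pair eta_continuous_tendsto[OF cont] lim[unfolded coupled_map_def])
  next
    assume bound: "monotone_limits_bound TYPE('a)"
    have "mixed_le (?s m) (?s (Suc m))" for m
      using funpow_coupled_map_mono[OF mono start, of m] by (simp add: funpow_swap1)
    then have le: "mixed_le (?s m) z" for m
      by (rule mixed_le_limit[OF bound _ lim])
    have null: "(\<lambda>m. eta (?s m) z) \<longlonglongrightarrow> 0"
      using lim by (simp add: tendsto_iff_eta_tendsto_0)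
    then have "\<forall>\<^sub>F m in sequentially. eta (?s m) z < 2 * \<epsilon>"
      using \<open>\<epsilon> > 0\<close> by (intro order_tendstoD(2)) auto
    then have "\<forall>\<^sub>F m in sequentially. norm (eta (?T (?s m)) (?T z)) \<le> l * eta (?s m) z"
      by eventually_elim (simp add: coupled_map_contractive[OF contr le])
    moreover have "(\<lambda>m. l * eta (?s m) z) \<longlonglongrightarrow> 0"
      using tendsto_mult_left[OF null, of l] by simp
    ultimately show ?thesis
      unfolding tendsto_iff_eta_tendsto_0[where p = "?T z"] by (rule Lim_null_comparison)
  qed
  moreover have "(\<lambda>m. ?T (?s m)) \<longlonglongrightarrow> z"
    using LIMSEQ_Suc[OF lim] by simp
  ultimately show ?thesis
    by (rule LIMSEQ_unique)
qed

section \<open>Equality of the components\<close>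

lemma coupled_iterates_limit_diagonal:
  assumes "0 < l" and "l < 1"
    and asym: "geometrically_asymptotic (coupled_map F) l (x0, y0) (y0, x0)"
    and lim: "(\<lambda>m. (coupled_map F ^^ m) (x0, y0)) \<longlonglongrightarrow> (x, y)"
  shows "x = y"
proof -
  let ?x = "\<lambda>m. coupled_iterate F m x0 y0" and ?y = "\<lambda>m. coupled_iterate F m y0 x0"
  have "?x \<longlonglongrightarrow> x" "?y \<longlonglongrightarrow> y"
    using tendsto_fst[OF lim] tendsto_snd[OF lim] by (simp_all add: funpow_coupled_map)
  then have "(\<lambda>m. 2 * dist (?x m) (?y m)) \<longlonglongrightarrow> 2 * dist x y"
    by (intro tendsto_mult tendsto_const tendsto_dist)
  moreover have "(\<lambda>m. 2 * dist (?x m) (?y m)) \<longlonglongrightarrow> 0"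
    using geometrically_asymptotic_tendsto_0[OF asym assms(1,2)]
    by (simp add: funpow_coupled_map eta_def dist_commute)
  ultimately have "2 * dist x y = 0"
    by (rule LIMSEQ_unique)
  then show ?thesis
    by simp
qed

theorem theorem2p5:
  fixes F :: "'a::{order, complete_space} \<times> 'a \<Rightarrow> 'a"
    and \<epsilon> l :: real
    and x0 y0 :: 'a
  assumes "\<epsilon> > 0" and "0 < l" and "l < 1"
    and "order_chainable \<epsilon> TYPE('a)"
    and "eta_continuous F \<or> monotone_limits_bound TYPE('a)"
    and "mixed_monotone F"
    and "unif_locally_contractive \<epsilon> l F"
    and "x0 \<le> F (x0, y0)" and "y0 \<ge> F (y0, x0)"
    and "x0 \<le> y0 \<or> y0 \<le> x0"
  shows "(\<exists>x y. limit_coupled_fixed_point F x0 y0 x y) \<and>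
         (\<forall>x y. limit_coupled_fixed_point F x0 y0 x y \<longrightarrow> x = y)"
proof -
  note asymptotic = mixed_le_imp_geometrically_asymptotic[OF assms(2-4,6,7)]
  have start: "mixed_le (x0, y0) (coupled_map F (x0, y0))"
    using assms(8,9) by (simp add: mixed_le_def coupled_map_def)
  obtain z where z: "(\<lambda>m. (coupled_map F ^^ m) (x0, y0)) \<longlonglongrightarrow> z"
    using coupled_iterates_convergent[OF assms(2-4,6,7) start] by (auto simp: convergent_def)
  have "coupled_map F z = z"
    by (rule coupled_iterates_limit_fixed[OF assms(1,5,6,7) start z])
  with z have "limit_coupled_fixed_point F x0 y0 (fst z) (snd z)"
    by (simp add: limit_coupled_fixed_point_iff)
  moreover have "geometrically_asymptotic (coupled_map F) l (x0, y0) (y0, x0)"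
    using assms(10)
  proof
    assume "x0 \<le> y0"
    then show ?thesis
      by (intro asymptotic) (simp add: mixed_le_def)
  next
    assume "y0 \<le> x0"
    then show ?thesis
      by (intro geometrically_asymptotic_sym[OF asymptotic]) (simp add: mixed_le_def)
  qed
  then have "x = y" if "limit_coupled_fixed_point F x0 y0 x y" for x y
    using coupled_iterates_limit_diagonal[OF assms(2,3)] that
    unfolding limit_coupled_fixed_point_iff by blast
  ultimately show ?thesis
    by blast
qed

end
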